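(* For all real $p$ with $\frac{\sqrt5-1}{\sqrt5+1}<p<1$ and all positive integers $k$ and $\ell$, $$R(k,\ell)\le 4(k+\ell)\left(\frac{1+\sqrt5}{2}p+\frac{1-\sqrt5}{2}\right)^{-k/2}(1-p)^{-\ell}.$$
   Context: $R(k,\ell)$ denotes the two-color Ramsey number: the smallest positive integer $N$ such that every red-blue coloring of the edges of the complete graph $K_N$ contains a complete subgraph on $k$ vertices with all edges red or a complete subgraph on $\ell$ vertices with all edges blue. *)

theory Defs
  imports Complex_Main "HOL-Library.Ramsey"
begin

text \<open>
  A red-blue colouring of the edges of the complete graph on \<open>{..<N}\<close> is a function
  from the 2-subsets of \<open>{..<N}\<close> to \<open>{0, 1}\<close>, with 0 for red and 1 for blue; then
  \<open>partn_lst {..<N} [k, l] 2\<close> says that every such colouring admits a red \<open>k\<close>-clique or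
  a blue \<open>l\<close>-clique.
\<close>

definition ramsey_number :: "nat \<Rightarrow> nat \<Rightarrow> nat" where
  "ramsey_number k l = (LEAST N. 0 < N \<and> partn_lst {..<N} [k, l] 2)"

lemma ramsey_number_pos: "0 < ramsey_number k l"
  and partn_lst_ramsey_number: "partn_lst {..<ramsey_number k l} [k, l] 2"
proof -
  obtain M :: nat where "partn_lst {..<M} [k, l] 2"
    using ramsey_full by blast
  then have "0 < Suc M \<and> partn_lst {..<Suc M} [k, l] 2"
    by (meson partn_lst_greater_resource le_SucI order_refl zero_less_Suc)
  then have "0 < ramsey_number k l \<and> partn_lst {..<ramsey_number k l} [k, l] 2"
    unfolding ramsey_number_def by (rule LeastI)
  then show "0 < ramsey_number k l" "partn_lst {..<ramsey_number k l} [k, l] 2"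
    by auto
qed

end

theory Submission
  imports Defs
begin

text \<open>
  Write \<open>\<phi>\<close> for the golden ratio, \<open>\<epsilon> = 1 - p\<close>, \<open>x = 1 - \<phi>\<epsilon>\<close> (the base in the theorem) and
  \<open>\<gamma> = \<epsilon> / \<phi>\<close>, so that \<open>p = x + \<gamma>\<close>. The excess of \<open>(X, Y)\<close> is the number of red pairs minus
  \<open>p|X||Y|\<close>. By convexity, for a typical \<open>v \<in> X\<close>, passing from \<open>Y\<close> to the red neighbourhood of
  \<open>v\<close> in \<open>Y\<close> retains a proportion \<open>p\<close> of the excess, and this splits into the contributions
  of the red and of the blue neighbourhood of \<open>v\<close> in \<open>X\<close>. Induction shows that, if there is
  no red \<open>k\<close>-clique, no blue \<open>m\<close>-clique in \<open>X\<close> and no blue \<open>l\<close>-clique in \<open>Y\<close>, the excess is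
  at most of order \<open>\<epsilon> x\<^sup>-\<^sup>k \<gamma>\<^sup>-\<^sup>m (\<phi>\<epsilon>)\<^sup>-\<^sup>l\<close>; for \<open>m = l\<close> this is \<open>\<epsilon> (x\<^sup>-\<^sup>k\<^sup>/\<^sup>2 \<epsilon>\<^sup>-\<^sup>l)\<^sup>2\<close>.
  If some blue degree is at least \<open>\<epsilon>n(1 - 1/(k + l))\<close>, then induction on \<open>l\<close> applies to the
  blue neighbourhood. Otherwise the excess of \<open>(V, V)\<close> has order \<open>\<epsilon>n\<^sup>2/(k + l)\<close>,
  which bounds \<open>n\<close>.
\<close>

section \<open>Cliques and neighbourhoods in a two-colouring\<close>

definition clique_free :: "('a \<Rightarrow> 'a \<Rightarrow> bool) \<Rightarrow> nat \<Rightarrow> 'a set \<Rightarrow> bool" where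
  "clique_free E k S \<longleftrightarrow> (\<forall>K. K \<subseteq> S \<longrightarrow> finite K \<longrightarrow> pairwise E K \<longrightarrow> card K \<noteq> k)"

lemma clique_free_subset: "clique_free E k S \<Longrightarrow> T \<subseteq> S \<Longrightarrow> clique_free E k T"
  unfolding clique_free_def by blast

text \<open>The empty set is a clique of size 0. This makes the hypothesis at size 0 contradictory,
  so the inductions below may assume positive clique sizes.\<close>

lemma not_clique_free_0: "\<not> clique_free E 0 S"
  unfolding clique_free_def by (auto intro!: exI[of _ "{}"])

lemma clique_free_1_empty: "clique_free E (Suc 0) S \<Longrightarrow> S = {}"
  unfolding clique_free_def by (force simp: pairwise_singleton)

lemma clique_free_neighbours:
  assumes "clique_free E (Suc k) V" "v \<in> V" "S \<subseteq> V" "\<And>y. y \<in> S \<Longrightarrow> y \<noteq> v \<and> E v y \<and> E y v"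
  shows "clique_free E k S"
  unfolding clique_free_def
proof (intro allI impI notI)
  fix K assume K: "K \<subseteq> S" "finite K" "pairwise E K" "card K = k"
  have "pairwise E (insert v K)"
    using K assms(4) by (auto simp: pairwise_insert)
  moreover have "v \<notin> K" using K(1) assms(4) by blast
  ultimately show False
    using assms(1-3) K unfolding clique_free_def
    by (metis card_insert_disjoint finite_insert insert_subset subset_trans)
qed

locale two_coloring =
  fixes R :: "'a \<Rightarrow> 'a \<Rightarrow> bool"
  assumes R_sym: "R x y \<Longrightarrow> R y x" and R_irrefl: "\<not> R x x"
begin

definition B :: "'a \<Rightarrow> 'a \<Rightarrow> bool" where
  "B x y \<longleftrightarrow> x \<noteq> y \<and> \<not> R x y"

definition red_nbrs :: "'a \<Rightarrow> 'a set \<Rightarrow> 'a set" where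
  "red_nbrs v S = {y \<in> S. R v y}"

definition blue_nbrs :: "'a \<Rightarrow> 'a set \<Rightarrow> 'a set" where
  "blue_nbrs v S = {y \<in> S. B v y}"

text \<open>The sets may overlap and ordered pairs are counted. Since \<open>R\<close> is
  irreflexive, a diagonal pair contributes \<open>- p\<close>, which matters for
  \<open>X = Y\<close>.\<close>

definition excess :: "real \<Rightarrow> 'a set \<Rightarrow> 'a set \<Rightarrow> real" where
  "excess p X Y = (\<Sum>x\<in>X. \<Sum>y\<in>Y. of_bool (R x y) - p)"

lemma red_nbrs_subset: "red_nbrs v S \<subseteq> S" and blue_nbrs_subset: "blue_nbrs v S \<subseteq> S"
  by (auto simp: red_nbrs_def blue_nbrs_def)

lemma nbrs_partition:
  assumes "v \<in> S"
  shows "S = insert v (red_nbrs v S \<union> blue_nbrs v S)"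
    and "v \<notin> red_nbrs v S \<union> blue_nbrs v S" and "red_nbrs v S \<inter> blue_nbrs v S = {}"
  using assms R_irrefl by (auto simp: red_nbrs_def blue_nbrs_def B_def)

lemma card_nbrs:
  assumes "finite S" "v \<in> S"
  shows "card S = Suc (card (red_nbrs v S) + card (blue_nbrs v S))"
proof -
  have fin: "finite (red_nbrs v S)" "finite (blue_nbrs v S)"
    using assms(1) by (auto simp: red_nbrs_def blue_nbrs_def)
  have "card S = card (insert v (red_nbrs v S \<union> blue_nbrs v S))"
    using nbrs_partition(1)[OF assms(2)] by simp
  also have "\<dots> = Suc (card (red_nbrs v S \<union> blue_nbrs v S))"
    using fin nbrs_partition(2)[OF assms(2)] by simp
  finally show ?thesis
    using fin nbrs_partition(3)[OF assms(2)] by (simp add: card_Un_disjoint)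
qed

lemma clique_free_red_nbrs:
  "clique_free R (Suc k) V \<Longrightarrow> v \<in> V \<Longrightarrow> S \<subseteq> V \<Longrightarrow> clique_free R k (red_nbrs v S)"
  by (rule clique_free_neighbours[of R k V v])
    (use R_sym R_irrefl in \<open>auto simp: red_nbrs_def\<close>)

lemma clique_free_blue_nbrs:
  "clique_free B (Suc k) V \<Longrightarrow> v \<in> V \<Longrightarrow> S \<subseteq> V \<Longrightarrow> clique_free B k (blue_nbrs v S)"
  by (rule clique_free_neighbours[of B k V v])
    (use R_sym in \<open>auto simp: blue_nbrs_def B_def\<close>)

section \<open>Weighted Erdos-Szekeres bound\<close>

text \<open>Remove a vertex \<open>v\<close>: its red neighbourhood costs a factor \<open>x\<close>,
  its blue one a factor \<open>1 - x\<close>, and these weights sum to 1. The \<open>- 1\<close>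
  accounts for \<open>v\<close>.\<close>

lemma erdos_szekeres_bound:
  fixes x :: real
  assumes "0 < x" "x < 1" "finite S" "clique_free R k S" "clique_free B l S"
  shows "real (card S) \<le> (1 / x) ^ k * (1 / (1 - x)) ^ l - 1"
  using assms(3-5)
proof (induction "card S" arbitrary: S k l rule: less_induct)
  case less
  show ?case
  proof (cases "S = {}")
    case True
    have "1 \<le> (1 / x) ^ k * (1 / (1 - x)) ^ l"
      using mult_mono[OF one_le_power[of "1/x" k] one_le_power[of "1/(1-x)" l]] assms by simp
    then show ?thesis using True by simp
  next
    case False
    then obtain v where v: "v \<in> S" by blast
    obtain k' l' where kl: "k = Suc k'" "l = Suc l'"
      using less.prems not_clique_free_0 by (metis not0_implies_Suc)
    note c = card_nbrs[OF less.prems(1) v]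
    have "real (card (red_nbrs v S)) \<le> (1 / x) ^ k' * (1 / (1 - x)) ^ l - 1"
      using less.prems v kl c red_nbrs_subset
      by (intro less.hyps) (auto intro: clique_free_red_nbrs clique_free_subset finite_subset)
    moreover have "real (card (blue_nbrs v S)) \<le> (1 / x) ^ k * (1 / (1 - x)) ^ l' - 1"
      using less.prems v kl c blue_nbrs_subset
      by (intro less.hyps) (auto intro: clique_free_blue_nbrs clique_free_subset finite_subset)
    moreover have "(1 / x) ^ k' * (1 / (1 - x)) ^ l + (1 / x) ^ k * (1 / (1 - x)) ^ l'
        = (1 / x) ^ k * (1 / (1 - x)) ^ l"
      using assms(1,2) unfolding kl by (simp add: field_simps)
    ultimately show ?thesis using c by simp
  qed
qed

section \<open>Bounds on the excess\<close>

lemma excess_eq: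
  assumes "finite X" "finite Y"
  shows "excess p X Y = (\<Sum>y\<in>Y. real (card (red_nbrs y X)) - p * real (card X))"
proof -
  have "excess p X Y = (\<Sum>y\<in>Y. \<Sum>x\<in>X. of_bool (R x y) - p)"
    unfolding excess_def by (rule sum.swap)
  also have "\<dots> = (\<Sum>y\<in>Y. real (card (red_nbrs y X)) - p * real (card X))"
  proof (rule sum.cong)
    fix y
    have "{x \<in> X. R x y} = red_nbrs y X" using R_sym by (auto simp: red_nbrs_def)
    then show "(\<Sum>x\<in>X. of_bool (R x y) - p) = real (card (red_nbrs y X)) - p * real (card X)"
      using assms by (simp add: sum_subtractf sum_of_bool_eq Int_def)
  qed simp
  finally show ?thesis .
qed

text \<open>The set \<open>X\<close> splits into \<open>v\<close>, its red and its blue neighbours;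
  \<open>v\<close> is joined in red to all of \<open>red_nbrs v Y\<close>, which gives the last
  term.\<close>

lemma excess_red_nbrs_split:
  assumes "finite X" "finite Y" "v \<in> X"
  shows "excess p X (red_nbrs v Y) = excess p (red_nbrs v X) (red_nbrs v Y)
    + excess p (blue_nbrs v X) (red_nbrs v Y) + (1 - p) * real (card (red_nbrs v Y))"
proof -
  have fin: "finite (red_nbrs v X)" "finite (blue_nbrs v X)"
    using assms(1) by (auto simp: red_nbrs_def blue_nbrs_def)
  note part = nbrs_partition[OF assms(3)]
  have "excess p X (red_nbrs v Y)
      = excess p (insert v (red_nbrs v X \<union> blue_nbrs v X)) (red_nbrs v Y)"
    using part(1) by simp
  also have "\<dots> = (\<Sum>y\<in>red_nbrs v Y. of_bool (R v y) - p)
      + excess p (red_nbrs v X) (red_nbrs v Y) + excess p (blue_nbrs v X) (red_nbrs v Y)"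
    unfolding excess_def using fin part(2,3) by (simp add: sum.union_disjoint)
  also have "(\<Sum>y\<in>red_nbrs v Y. of_bool (R v y) - p) = (\<Sum>y\<in>red_nbrs v Y. 1 - p)"
    by (rule sum.cong) (auto simp: red_nbrs_def)
  finally show ?thesis by simp
qed

text \<open>Double counting turns the right side into the sum of \<open>d y * (d y - m)\<close>. It
  exceeds the sum of \<open>m * (d y - m)\<close> by a sum of squares. On average over
  \<open>v\<close>, a proportion \<open>p\<close> of the excess thus survives.\<close>

lemma sum_excess_red_nbrs_ge:
  assumes "finite X" "finite Y"
  shows "p * real (card X) * excess p X Y \<le> (\<Sum>v\<in>X. excess p X (red_nbrs v Y))"
proof -
  define d where "d y = real (card (red_nbrs y X))" for y
  define m where "m = p * real (card X)"
  have "(\<Sum>v\<in>X. excess p X (red_nbrs v Y)) = (\<Sum>v\<in>X. \<Sum>y\<in>Y. of_bool (R v y) * (d y - m))"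
  proof (rule sum.cong)
    fix v
    have "finite (red_nbrs v Y)" using assms(2) by (simp add: red_nbrs_def)
    then have "excess p X (red_nbrs v Y) = (\<Sum>y\<in>{y \<in> Y. R v y}. d y - m)"
      using assms(1) by (simp add: excess_eq d_def m_def red_nbrs_def)
    also have "\<dots> = (\<Sum>y\<in>Y. of_bool (R v y) * (d y - m))"
      using assms(2) by (simp add: Int_def)
    finally show "excess p X (red_nbrs v Y) = (\<Sum>y\<in>Y. of_bool (R v y) * (d y - m))" .
  qed simp
  also have "\<dots> = (\<Sum>y\<in>Y. (\<Sum>v\<in>X. of_bool (R v y)) * (d y - m))"
    by (subst sum.swap) (simp add: sum_distrib_right)
  also have "\<dots> = (\<Sum>y\<in>Y. d y * (d y - m))"
  proof (rule sum.cong)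
    fix y
    have "{x \<in> X. R x y} = red_nbrs y X" using R_sym by (auto simp: red_nbrs_def)
    then show "(\<Sum>v\<in>X. of_bool (R v y)) * (d y - m) = d y * (d y - m)"
      using assms(1) by (simp add: d_def sum_of_bool_eq Int_def)
  qed simp
  also have "\<dots> \<ge> (\<Sum>y\<in>Y. m * (d y - m))"
  proof (rule sum_mono)
    fix y
    have "d y * (d y - m) - m * (d y - m) = (d y - m)\<^sup>2"
      by (simp add: power2_eq_square algebra_simps)
    then show "m * (d y - m) \<le> d y * (d y - m)"
      using zero_le_power2[of "d y - m"] by linarith
  qed
  also have "(\<Sum>y\<in>Y. m * (d y - m)) = p * real (card X) * excess p X Y"
    using assms by (simp add: excess_eq d_def m_def sum_distrib_left)
  finally show ?thesis .
qed

text \<open>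
  The term \<open>- 1\<close> absorbs the contribution \<open>(1 - p) |Y|\<close> of the chosen vertex itself, and the
  factor \<open>(1 - p) / (1 - g)\<close> is what makes this exact.
\<close>

lemma excess_upper_bound:
  fixes p x g :: real
  assumes x: "0 < x" "x < 1" and g: "0 < g" "g < 1" and p: "p = x + g" "p < 1"
    and "finite X" "finite Y" "clique_free R k (X \<union> Y)" "clique_free B m X" "clique_free B l Y"
  shows "excess p X Y
    \<le> (1 - p) / (1 - g) * ((1 / g) ^ (m - 1) - 1) * ((1 / x) ^ k * (1 / (1 - x)) ^ l)"
  using assms(7-)
proof (induction "card X" arbitrary: X Y k m rule: less_induct)
  case less
  define C where "C = (1 - p) / (1 - g)"
  define Q where "Q = (1 / x) ^ k * (1 / (1 - x)) ^ l"
  have C0: "0 \<le> C" and Q0: "0 < Q" using x g p by (auto simp: C_def Q_def)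
  show ?case
  proof (cases "X = {}")
    case True
    have "1 \<le> (1 / g) ^ (m - 1)" using g by (intro one_le_power) simp
    then have "0 \<le> C * ((1 / g) ^ (m - 1) - 1) * Q" using C0 Q0 by simp
    then show ?thesis unfolding C_def Q_def using True by (simp add: excess_def)
  next
    case False
    obtain k' where k: "k = Suc k'"
      using less.prems not_clique_free_0 by (metis not0_implies_Suc)
    \<comment> \<open>A nonempty \<open>X\<close> contains a blue clique of size 1, so
      \<open>m\<close> is at least 2 and \<open>m - 1\<close> can still drop by one.\<close>
    obtain m' where m: "m = Suc (Suc m')"
      using less.prems False not_clique_free_0 clique_free_1_empty by (metis not0_implies_Suc)
    define G where "G = (1 / g) ^ Suc m'"
    have gG: "(1 / g) ^ m' = g * G" using g by (simp add: G_def)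
    have cardY: "real (card Y) \<le> Q"
      using erdos_szekeres_bound[OF x less.prems(2) _ less.prems(5), of k]
        clique_free_subset[OF less.prems(3)] by (simp add: Q_def)
    \<comment> \<open>Induction on both parts of \<open>X\<close>: in the red part \<open>k\<close>
      drops, which scales \<open>Q\<close> by \<open>x\<close>; in the blue part \<open>m\<close>
      drops, which scales \<open>G\<close> by \<open>g\<close>. The last term bounds the
      contribution of \<open>v\<close>.\<close>
    have step: "excess p X (red_nbrs v Y)
        \<le> C * (G - 1) * (x * Q) + C * (g * G - 1) * Q + (1 - p) * Q"
      if v: "v \<in> X" for v
    proof -
      have sub: "red_nbrs v X \<subseteq> X" "blue_nbrs v X \<subseteq> X" "red_nbrs v Y \<subseteq> Y"
        by (auto simp: red_nbrs_subset blue_nbrs_subset)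
      have fin: "finite (red_nbrs v X)" "finite (blue_nbrs v X)" "finite (red_nbrs v Y)"
        using sub less.prems(1,2) by (auto intro: finite_subset)
      have less_card: "card (red_nbrs v X) < card X" "card (blue_nbrs v X) < card X"
        using card_nbrs[OF less.prems(1) v] by auto
      have "red_nbrs v X \<union> red_nbrs v Y = red_nbrs v (X \<union> Y)" by (auto simp: red_nbrs_def)
      then have "clique_free R k' (red_nbrs v X \<union> red_nbrs v Y)"
        using clique_free_red_nbrs[of k' "X \<union> Y" v] less.prems(3) v k by simp
      from less.hyps[OF less_card(1) fin(1,3) this, of m]
      have "excess p (red_nbrs v X) (red_nbrs v Y)
          \<le> C * (G - 1) * ((1 / x) ^ k' * (1 / (1 - x)) ^ l)"
        using less.prems(4,5) sub by (simp add: C_def G_def m clique_free_subset)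
      also have "(1 / x) ^ k' * (1 / (1 - x)) ^ l = x * Q" using x by (simp add: Q_def k)
      finally have red: "excess p (red_nbrs v X) (red_nbrs v Y) \<le> C * (G - 1) * (x * Q)" .
      have "clique_free R k (blue_nbrs v X \<union> red_nbrs v Y)"
        using clique_free_subset[OF less.prems(3)] sub by blast
      moreover have "clique_free B (Suc m') (blue_nbrs v X)"
        using clique_free_blue_nbrs[of "Suc m'" X v] less.prems(4) v m by simp
      ultimately have "excess p (blue_nbrs v X) (red_nbrs v Y) \<le> C * ((1 / g) ^ m' - 1) * Q"
        using less.hyps[OF less_card(2) fin(2,3), of k "Suc m'"] less.prems(5) sub(3)
        by (simp add: C_def Q_def clique_free_subset)
      then have blue: "excess p (blue_nbrs v X) (red_nbrs v Y) \<le> C * (g * G - 1) * Q"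
        unfolding gG .
      have "real (card (red_nbrs v Y)) \<le> Q"
        using cardY card_mono[OF less.prems(2) sub(3)] by linarith
      then have "(1 - p) * real (card (red_nbrs v Y)) \<le> (1 - p) * Q"
        using p by (simp add: mult_left_mono)
      then show ?thesis
        using red blue excess_red_nbrs_split[OF less.prems(1,2) v, of p] by linarith
    qed
    have C: "(1 - p) = C * (1 - g)" using g by (simp add: C_def)
    \<comment> \<open>Because \<open>x + g = p\<close>, the sum is exactly \<open>p\<close> times
      the target, and this \<open>p\<close> cancels the one from averaging.\<close>
    have "C * (G - 1) * (x * Q) + C * (g * G - 1) * Q + (1 - p) * Q = p * (C * (G - 1) * Q)"
      unfolding C unfolding p(1) by (simp add: algebra_simps)
    then have "(\<Sum>v\<in>X. excess p X (red_nbrs v Y)) \<le> (\<Sum>v\<in>X. p * (C * (G - 1) * Q))"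
      using step by (intro sum_mono) auto
    then have "p * real (card X) * excess p X Y \<le> p * real (card X) * (C * (G - 1) * Q)"
      using sum_excess_red_nbrs_ge[OF less.prems(1,2), of p] by (simp add: mult_ac)
    moreover have "0 < p * real (card X)"
      using x g p False less.prems(1) by (simp add: card_gt_0_iff)
    ultimately have "excess p X Y \<le> C * (G - 1) * Q"
      by (simp only: mult_le_cancel_left_pos)
    then show ?thesis by (simp add: C_def G_def Q_def m)
  qed
qed

text \<open>Each red degree is at least \<open>card V - 1 - b\<close>, where the 1 is the vertex
  itself.\<close>

lemma excess_lower_bound:
  assumes "finite V" "\<And>v. v \<in> V \<Longrightarrow> real (card (blue_nbrs v V)) \<le> b"
  shows "real (card V) * ((1 - p) * real (card V) - 1 - b) \<le> excess p V V"
proof -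
  have "(\<Sum>v\<in>V. (1 - p) * real (card V) - 1 - b)
      \<le> (\<Sum>v\<in>V. real (card (red_nbrs v V)) - p * real (card V))"
  proof (rule sum_mono)
    fix v assume "v \<in> V"
    then show "(1 - p) * real (card V) - 1 - b \<le> real (card (red_nbrs v V)) - p * real (card V)"
      using card_nbrs[OF assms(1), of v] assms(2)[of v] by (simp add: algebra_simps)
  qed
  then show ?thesis using excess_eq[OF assms(1,1)] by simp
qed

section \<open>Size of a set without large monochromatic cliques\<close>

text \<open>Here \<open>r\<close> stands for the square root of \<open>(1 / x) ^ k\<close>. The
  relation \<open>gx\<close> turns the excess bound for equal blue clique sizes into a multiple of a
  square.\<close>

lemma card_clique_free_le:
  fixes p x g r :: real
  assumes x: "0 < x" "x < 1" and g: "0 < g" "g \<le> 1 / 2" and p: "p = x + g" "p < 1"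
    and gx: "g * (1 - x) = (1 - p)\<^sup>2"
    and r: "r\<^sup>2 = (1 / x) ^ k" "1 \<le> r"
    and "finite V" "clique_free R k V" "clique_free B l V"
  shows "real (card V) \<le> 2 * (real k + real l) * (r * (1 / (1 - p)) ^ l)"
  using assms(10-)
proof (induction l arbitrary: V)
  case 0
  then show ?case using not_clique_free_0 by blast
next
  case (Suc l)
  define e where "e = 1 - p"
  define A where "A = r * (1 / e) ^ Suc l"
  define s where "s = real k + real (Suc l)"
  define n where "n = real (card V)"
  have e: "0 < e" "e < 1" using x g p by (auto simp: e_def)
  have s: "1 \<le> s" by (simp add: s_def)
  have "1 \<le> (1 / e) ^ l" using e by (intro one_le_power) simp
  then have eA: "1 \<le> e * A"
    using mult_mono[of 1 r 1 "(1 / e) ^ l"] r e by (simp add: A_def)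
  have "1 * 1 \<le> r * (1 / e) ^ Suc l"
    using r e by (intro mult_mono one_le_power) auto
  then have A: "1 \<le> A" by (simp add: A_def)
  have "n \<le> 2 * s * A"
  \<comment> \<open>With this threshold, the induction hypothesis, whose factor is
    \<open>s - 1\<close>, returns exactly the factor \<open>s\<close>; below it, the excess per
    vertex is at least \<open>n * e / s - 1\<close>.\<close>
  proof (cases "\<exists>v\<in>V. n * e * (s - 1) / s < card (blue_nbrs v V)")
    case True
    then obtain v where v: "v \<in> V" "n * e * (s - 1) / s < card (blue_nbrs v V)" by blast
    have "real (card (blue_nbrs v V)) \<le> 2 * (real k + real l) * (r * (1 / (1 - p)) ^ l)"
      using Suc.prems v(1) blue_nbrs_subset
      by (intro Suc.IH) (auto intro: clique_free_blue_nbrs clique_free_subset finite_subset)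
    also have "\<dots> = 2 * (s - 1) * (e * A)"
      using e by (simp add: s_def A_def e_def)
    finally have *: "n * e * (s - 1) / s < 2 * (s - 1) * (e * A)" using v(2) by linarith
    \<comment> \<open>For \<open>s = 1\<close> both sides of the strict inequality would
      vanish.\<close>
    then have "s \<noteq> 1" by auto
    then have "0 < e * (s - 1) / s" using s e by simp
    moreover have "(e * (s - 1) / s) * n < (e * (s - 1) / s) * (2 * s * A)"
      using * s by (simp add: mult_ac)
    ultimately show ?thesis using mult_less_cancel_left_pos by (metis less_imp_le)
  next
    case False
    show ?thesis
    proof (rule ccontr)
      assume "\<not> n \<le> 2 * s * A"
      then have n: "2 * s * A < n" by simp
      have "n * (e * n - 1 - n * e * (s - 1) / s) \<le> excess p V V"
        unfolding n_def e_def
        by (rule excess_lower_bound[OF Suc.prems(1)]) (use False in \<open>force simp: n_def e_def\<close>)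
      moreover have "e * n - 1 - n * e * (s - 1) / s = n * e / s - 1"
        using s by (simp add: field_simps)
      ultimately have lower: "n * (n * e / s - 1) \<le> excess p V V" by simp
      have "excess p V V \<le> e / (1 - g) * ((1 / g) ^ l - 1) * ((1 / x) ^ k * (1 / (1 - x)) ^ Suc l)"
        using excess_upper_bound[OF x g(1) _ p Suc.prems(1,1), of k "Suc l" "Suc l"] g Suc.prems
        by (simp add: e_def)
      also have "\<dots> \<le> e / (1 - g) * (1 / g) ^ l * ((1 / x) ^ k * (1 / (1 - x)) ^ Suc l)"
        using e g x by (intro mult_right_mono mult_left_mono) auto
      \<comment> \<open>The exponent \<open>l\<close> comes from \<open>m - 1\<close>. Taking out a
        factor \<open>g\<close> raises it to \<open>Suc l\<close>, so that \<open>gx\<close> yields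
        a square; \<open>g / (1 - g)\<close> is at most 1 as \<open>g \<le> 1 / 2\<close>.\<close>
      also have "\<dots> = g / (1 - g) * (e * (r\<^sup>2 * ((1 / g) ^ Suc l * (1 / (1 - x)) ^ Suc l)))"
        unfolding r(1) using g by simp
      also have "(1 / g) ^ Suc l * (1 / (1 - x)) ^ Suc l = ((1 / e) ^ Suc l)\<^sup>2"
      proof -
        have "1 / g * (1 / (1 - x)) = (1 / e)\<^sup>2" using gx by (simp add: e_def power_divide)
        then show ?thesis
          by (metis power_mult power_mult_distrib mult.commute)
      qed
      also have "r\<^sup>2 * ((1 / e) ^ Suc l)\<^sup>2 = A\<^sup>2" by (simp only: A_def power_mult_distrib)
      also have "g / (1 - g) * (e * A\<^sup>2) \<le> 1 * (e * A\<^sup>2)"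
        using g e by (intro mult_right_mono) (auto simp: field_simps)
      finally have upper: "excess p V V \<le> A * (e * A)" by (simp add: power2_eq_square mult_ac)
      have "2 * (e * A) < n * e / s"
        using mult_strict_right_mono[OF n e(1)] s by (simp add: field_simps)
      \<comment> \<open>One of the two copies of \<open>e * A\<close> absorbs the
        \<open>- 1\<close>; hence the factor 2 in the bound.\<close>
      then have "e * A < n * e / s - 1" using eA by linarith
      moreover have "A < n" using n mult_right_mono[of 1 "2 * s" A] s A by linarith
      ultimately have "A * (e * A) < n * (n * e / s - 1)"
        using A eA by (intro mult_strict_mono) auto
      then show False using lower upper by linarith
    qed
  qed
  then show ?case by (simp add: n_def s_def A_def e_def)
qed

end

section \<open>From set colourings to the Ramsey number\<close>

lemma not_partn_lst_imp_two_coloring: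
  assumes "\<not> partn_lst {..<N} [k, l] 2"
  obtains R :: "nat \<Rightarrow> nat \<Rightarrow> bool" where "two_coloring R"
    "clique_free R k {..<N}" "clique_free (two_coloring.B R) l {..<N}"
proof -
  obtain f where f: "f \<in> nsets {..<N} 2 \<rightarrow> {..<2}"
    and no: "\<And>i H. i < 2 \<Longrightarrow> H \<in> nsets {..<N} ([k, l] ! i) \<Longrightarrow> \<not> f ` nsets H 2 \<subseteq> {i}"
    using assms unfolding partn_lst_def monochromatic_def by (auto simp: numeral_2_eq_2)
  define R where "R x y \<longleftrightarrow> x \<noteq> y \<and> f {x, y} = 0" for x y
  have R: "two_coloring R"
    by unfold_locales (auto simp: R_def insert_commute)
  interpret two_coloring R by (rule R)
  have mono: "clique_free E ([k, l] ! i) {..<N}"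
    if "i < 2" "\<And>x y. x < N \<Longrightarrow> y < N \<Longrightarrow> x \<noteq> y \<Longrightarrow> E x y \<Longrightarrow> f {x, y} = i" for E i
    unfolding clique_free_def
  proof (intro allI impI notI)
    fix K assume K: "K \<subseteq> {..<N}" "finite K" "pairwise E K" "card K = [k, l] ! i"
    have "f ` nsets K 2 \<subseteq> {i}"
    proof clarify
      fix e assume "e \<in> nsets K 2"
      then obtain x y where xy: "e = {x, y}" "x \<in> K" "y \<in> K" "x \<noteq> y"
        by (auto simp: nsets_2_eq)
      then have "E x y" using K(3) by (auto simp: pairwise_def)
      then show "f e = i" using that(2)[of x y] xy K(1) by auto
    qed
    then show False using no[OF that(1)] K by (auto simp: nsets_def)
  qed
  \<comment> \<open>Only the colours 0 and 1 occur, so a pair that is not red has colour 1.\<close>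
  have "f {x, y} = 1" if "x < N" "y < N" "x \<noteq> y" "B x y" for x y
  proof -
    have "{x, y} \<in> nsets {..<N} 2" using that by (auto simp: nsets_def)
    then have "f {x, y} < 2" using f by auto
    then show ?thesis using that by (auto simp: B_def R_def)
  qed
  then show thesis
    using that[OF R] mono[of 0 R] mono[of 1 B] by (simp add: R_def)
qed

theorem theorem2p4:
  fixes p :: real and k l :: nat
  assumes "(sqrt 5 - 1) / (sqrt 5 + 1) < p" and "p < 1"
    and "0 < k" and "0 < l"
  shows "real (ramsey_number k l) \<le>
    4 * (real k + real l)
      * ((1 + sqrt 5) / 2 * p + (1 - sqrt 5) / 2) powr (- (real k / 2))
      * (1 - p) powr (- real l)"
proof -
  define q where "q = (1 + sqrt 5) / 2"
  have q: "q\<^sup>2 = q + 1" "q * (q - 1) = 1"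
    by (simp_all add: q_def power2_eq_square field_simps)
  have "2\<^sup>2 \<le> (5::real)" by simp
  then have "3 / 2 \<le> q" using real_le_rsqrt[of 2 5] by (simp add: q_def)
  define x where "x = (1 + sqrt 5) / 2 * p + (1 - sqrt 5) / 2"
  have x_eq: "x = 1 - q * (1 - p)" by (simp add: x_def q_def field_simps)
  \<comment> \<open>By \<open>q * (q - 1) = 1\<close>, the factor \<open>q - 1\<close> is the
    reciprocal of the golden ratio.\<close>
  define g where "g = (q - 1) * (1 - p)"
  \<comment> \<open>The lower bound on \<open>p\<close> is precisely positivity of
    \<open>x\<close>.\<close>
  have "(sqrt 5 - 1) < p * (sqrt 5 + 1)"
    using assms(1) by (simp add: pos_divide_less_eq add_pos_pos)
  then have x0: "0 < x" by (simp add: x_def field_simps)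
  then have "q * (1 - p) < 1" by (simp add: x_eq)
  have x1: "x < 1" using \<open>3 / 2 \<le> q\<close> assms(2) by (simp add: x_eq)
  have g0: "0 < g" using \<open>3 / 2 \<le> q\<close> assms(2) by (simp add: g_def)
  have p: "p = x + g" by (simp add: x_eq g_def algebra_simps)
  have g1: "g \<le> 1 / 2"
  proof -
    \<comment> \<open>This exposes \<open>q * (1 - p) = 1 - x\<close>, which is below 1, so that
      \<open>g\<close> is at most \<open>2 - q\<close>.\<close>
    have "g = q * (1 - p) * (q - 1)\<^sup>2"
      using q by (simp add: g_def power2_eq_square algebra_simps)
    moreover have "(q - 1)\<^sup>2 = 2 - q" using q(1) by (simp add: power2_eq_square algebra_simps)
    moreover have "q * (1 - p) * (2 - q) \<le> 1 * (2 - q)"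
      using \<open>q * (1 - p) < 1\<close> calculation(2) zero_le_power2[of "q - 1"]
      by (intro mult_right_mono) auto
    ultimately show ?thesis using \<open>3 / 2 \<le> q\<close> by simp
  qed
  have gx: "g * (1 - x) = (1 - p)\<^sup>2"
  proof -
    have "g * (1 - x) = (q * (q - 1)) * (1 - p)\<^sup>2"
      by (simp add: g_def x_eq power2_eq_square)
    then show ?thesis using q(2) by simp
  qed
  define r where "r = x powr (- (real k / 2))"
  have "r\<^sup>2 = x powr (- real k)" by (simp add: r_def power2_eq_square flip: powr_add)
  then have r2: "r\<^sup>2 = (1 / x) ^ k"
    using x0 by (simp add: powr_minus powr_realpow power_one_over inverse_eq_divide)
  have r1: "1 \<le> r"
    using r2 one_le_power[of "1 / x" k] x0 x1 power2_le_imp_le[of 1 r] by (simp add: r_def)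
  have powr_l: "(1 - p) powr (- real l) = (1 / (1 - p)) ^ l"
    using assms(2) by (simp add: powr_minus powr_realpow power_one_over inverse_eq_divide)
  define A where "A = r * (1 / (1 - p)) ^ l"
  \<comment> \<open>By minimality of the Ramsey number, \<open>N\<close> vertices admit a good
    colouring unless \<open>N = 0\<close>, a case that the positivity condition in the definition
    sets apart.\<close>
  define N where "N = ramsey_number k l - 1"
  have "1 \<le> (1 / (1 - p)) ^ l" using assms(2) x0 g0 p by (intro one_le_power) simp
  then have "1 \<le> A" using mult_mono[OF r1, of 1] r1 by (simp add: A_def)
  then have kl: "1 \<le> (real k + real l) * A"
    using mult_mono[of 1 "real k + real l" 1 A] assms(3) by simp
  have "real N \<le> 2 * (real k + real l) * A"
  proof (cases "N = 0")
    case True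
    then show ?thesis using kl by linarith
  next
    case False
    have "\<not> (0 < N \<and> partn_lst {..<N} [k, l] 2)"
      using ramsey_number_pos[of k l] not_less_Least[of N] unfolding N_def ramsey_number_def
      by (metis (no_types, lifting) diff_less zero_less_one)
    then obtain R :: "nat \<Rightarrow> nat \<Rightarrow> bool" where R: "two_coloring R"
      "clique_free R k {..<N}" "clique_free (two_coloring.B R) l {..<N}"
      using False not_partn_lst_imp_two_coloring by blast
    show ?thesis
      using two_coloring.card_clique_free_le
        [OF R(1) x0 x1 g0 g1 p assms(2) gx r2 r1 finite_lessThan R(2,3)]
      by (simp add: A_def)
  qed
  moreover have "real (ramsey_number k l) = N + 1"
    using ramsey_number_pos[of k l] by (simp add: N_def)
  \<comment> \<open>By \<open>kl\<close>, the 1 added to \<open>N\<close> is at most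
    \<open>(real k + real l) * A\<close>, so the factor 4 suffices.\<close>
  ultimately have "real (ramsey_number k l) \<le> 4 * (real k + real l) * A" using kl by linarith
  then show ?thesis by (simp only: powr_l A_def r_def x_def mult.assoc)
qed

end
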